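(* Let $q$ be a prime power and $\mathcal{C}$ a $q$-divisible set of points of $\mathrm{PG}(v-1,q)$ (for some $v$) with $2\le n=|\mathcal{C}|\le q^2$. Then either $n=q^2$ or $q+1$ divides $n$. Moreover, every such value of $n$ (i.e. $n=q^2$, and every multiple of $q+1$ in $[2,q^2]$) is the cardinality of some $q$-divisible set of points in some projective space over $\mathbb{F}_q$.
   Context: $\mathrm{PG}(v-1,q)$ denotes the set of $1$-dimensional subspaces (points) of $\mathbb{F}_q^v$; hyperplanes are the $(v-1)$-dimensional subspaces of $\mathbb{F}_q^v$. A set $\mathcal{C}$ of points is called $\Delta$-divisible (for an integer $\Delta\ge1$) if there is an integer $u$ with $|\mathcal{C}\cap H|\equiv u\pmod{\Delta}$ for every hyperplane $H$, where $\mathcal{C}\cap H$ is the set of points of $\mathcal{C}$ contained in $H$. *)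

theory Defs
  imports Complex_Main "HOL-Library.Function_Algebras"
begin

text \<open>Vectors of F^v are modelled as functions nat => F vanishing from index v on.
  The ambient space of all functions nat => F is a vector space over F (pointwise scaling).\<close>

definition scaleF :: "'a::field \<Rightarrow> (nat \<Rightarrow> 'a) \<Rightarrow> (nat \<Rightarrow> 'a)" where
  "scaleF c x = (\<lambda>i. c * x i)"

lemma vector_space_scaleF: "vector_space (scaleF :: 'a::field \<Rightarrow> _)"
  by unfold_locales (auto simp: scaleF_def fun_eq_iff algebra_simps)

definition fspace :: "nat \<Rightarrow> (nat \<Rightarrow> 'a::field) set" where
  "fspace v = {x. \<forall>i\<ge>v. x i = 0}"

definition subspaces_dim :: "nat \<Rightarrow> nat \<Rightarrow> (nat \<Rightarrow> 'a::field) set set" where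
  "subspaces_dim v k = {U. U \<subseteq> fspace v \<and> module.subspace scaleF U \<and> vector_space.dim scaleF U = k}"

definition PG_points :: "nat \<Rightarrow> (nat \<Rightarrow> 'a::field) set set" where
  "PG_points v = subspaces_dim v 1"

definition PG_hyperplanes :: "nat \<Rightarrow> (nat \<Rightarrow> 'a::field) set set" where
  "PG_hyperplanes v = subspaces_dim v (v - 1)"

definition divisible_set :: "nat \<Rightarrow> nat \<Rightarrow> (nat \<Rightarrow> 'a::field) set set \<Rightarrow> bool" where
  "divisible_set \<Delta> v C \<longleftrightarrow> C \<subseteq> PG_points v \<and>
     (\<exists>u::nat. \<forall>H \<in> PG_hyperplanes v. card {P \<in> C. P \<subseteq> H} mod \<Delta> = u mod \<Delta>)"

end

theory Submission
  imports Defs "HOL-Library.Cardinality" "HOL-Library.Product_Plus"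
begin

text \<open>
  For a functional y on F^v let s(y) be the number of points of C in its kernel, and let n be the
  cardinality of C. Double counting gives the first two moments of s over all functionals. The first
  one, taken modulo q, forces s(y) to be congruent to n, and also yields a hyperplane with
  s(y) < n/q. Write n = A q + c with 0 \<le> c < q; then c q \<le> s(y) q < n gives c \<le> A. If c = A,
  then n = c (q + 1). If c < A < q, the sum of the nonnegative numbers (s(y) - c) (s(y) - c - q)
  (a product of consecutive multiples of q) evaluates by the moments to something negative.
  Conversely, any m pairwise disjoint lines have m (q + 1) points and the complement of a
  line in a plane has q^2; both are divisible because a line meets a hyperplane in 1 or q + 1 points.
\<close>

section \<open>Fibre counting for additive maps\<close>

interpretation scaleF: vector_space "scaleF :: 'a::field \<Rightarrow> _"
  by (rule vector_space_scaleF)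

lemma CARD_field_ge_2: "2 \<le> CARD('a::{field,finite})"
proof -
  have "card {0, 1 :: 'a} \<le> CARD('a)" by (rule card_mono) auto
  then show ?thesis by simp
qed

text \<open>Every nonempty fibre is in bijection with the kernel. Additivity is asked only on
  \<open>G\<close>, so the lemma applies to dot products on a subspace and to the difference map on
  a product of two subspaces.\<close>

lemma card_eq_card_image_times_kernel:
  fixes h :: "'b::ab_group_add \<Rightarrow> 'c::ab_group_add"
  assumes "finite G"
    and diff: "\<And>x y. x \<in> G \<Longrightarrow> y \<in> G \<Longrightarrow> x - y \<in> G"
    and h_diff: "\<And>x y. x \<in> G \<Longrightarrow> y \<in> G \<Longrightarrow> h (x - y) = h x - h y"
  shows "card G = card (h ` G) * card {x \<in> G. h x = 0}"
proof -
  have fibre: "card {x \<in> G. h x = z} = card {x \<in> G. h x = 0}" if "z \<in> h ` G" for z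
  proof -
    from that obtain x0 where x0: "x0 \<in> G" "h x0 = z" by auto
    \<comment> \<open>The reflection \<open>x0 - x\<close> is its own inverse and uses only closure
      under differences.\<close>
    have "bij_betw (\<lambda>x. x0 - x) {x \<in> G. h x = z} {x \<in> G. h x = 0}"
      by (rule bij_betw_byWitness[where f' = "\<lambda>x. x0 - x"]) (use x0 in \<open>auto simp: diff h_diff\<close>)
    then show ?thesis by (rule bij_betw_same_card)
  qed
  have "card G = (\<Sum>z\<in>h ` G. card {x \<in> G. h x = z})"
    using sum.image_gen[OF \<open>finite G\<close>, of "\<lambda>_. 1 :: nat" h] by simp
  also have "\<dots> = (\<Sum>z\<in>h ` G. card {x \<in> G. h x = 0})"
    using fibre by (rule sum.cong[OF refl])
  finally show ?thesis by simp
qed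

section \<open>Subspaces of a finite vector space\<close>

lemma subspace_fspace: "scaleF.subspace (fspace v :: (nat \<Rightarrow> 'a::field) set)"
  by (auto simp: scaleF.subspace_def fspace_def scaleF_def)

lemma fspace_mono: "v \<le> w \<Longrightarrow> fspace v \<subseteq> fspace w"
  by (auto simp: fspace_def)

lemma fspace_finite_card:
  "finite (fspace v :: (nat \<Rightarrow> 'a::{field,finite}) set) \<and>
   card (fspace v :: (nat \<Rightarrow> 'a) set) = CARD('a) ^ v"
proof (induction v)
  case 0
  have "fspace 0 = {0 :: nat \<Rightarrow> 'a}" by (auto simp: fspace_def fun_eq_iff)
  then show ?case by simp
next
  case (Suc v)
  let ?ext = "\<lambda>(c :: 'a, x :: nat \<Rightarrow> 'a). x(v := c)"
  have eq: "fspace (Suc v) = ?ext ` (UNIV \<times> fspace v)"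
  proof (intro equalityI subsetI)
    fix x :: "nat \<Rightarrow> 'a" assume "x \<in> fspace (Suc v)"
    then have "(x v, x(v := 0)) \<in> UNIV \<times> fspace v" "x = ?ext (x v, x(v := 0))"
      by (auto simp: fspace_def le_Suc_eq Suc_le_eq)
    then show "x \<in> ?ext ` (UNIV \<times> fspace v)" by blast
  qed (auto simp: fspace_def)
  have "inj_on ?ext (UNIV \<times> fspace v)"
  proof (rule inj_onI, clarify)
    fix c d :: 'a and x y :: "nat \<Rightarrow> 'a"
    assume xy: "x \<in> fspace v" "y \<in> fspace v" and e: "x(v := c) = y(v := d)"
    have "x i = y i" for i
      using fun_cong[OF e, of i] xy by (cases "i = v") (auto simp: fspace_def)
    moreover have "c = d" using fun_cong[OF e, of v] by simp
    ultimately show "c = d \<and> x = y" by auto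
  qed
  then show ?case using Suc unfolding eq
    by (simp add: card_image card_cartesian_product)
qed

lemmas finite_fspace = fspace_finite_card[THEN conjunct1]
lemmas card_fspace = fspace_finite_card[THEN conjunct2]

text \<open>Each vector in the span of \<open>insert a B\<close> is uniquely a multiple of
  \<open>a\<close> plus a vector in the span of \<open>B\<close>, so every new basis vector
  multiplies the size by q.\<close>

lemma card_span_independent:
  fixes B :: "(nat \<Rightarrow> 'a::{field,finite}) set"
  assumes "finite B" "scaleF.independent B"
  shows "card (scaleF.span B) = CARD('a) ^ card B"
  using assms
proof (induction B)
  case empty
  then show ?case by simp
next
  case (insert a B)
  let ?f = "\<lambda>(c, x). scaleF c a + x"
  have a: "a \<notin> scaleF.span B" and B: "scaleF.independent B"
    using insert.prems insert.hyps by (auto simp: scaleF.independent_insert)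
  have eq: "scaleF.span (insert a B) = ?f ` (UNIV \<times> scaleF.span B)"
    unfolding scaleF.span_insert
  proof (intro equalityI subsetI)
    fix x assume "x \<in> {x. \<exists>k. x - scaleF k a \<in> scaleF.span B}"
    then obtain k where "x - scaleF k a \<in> scaleF.span B" by auto
    then show "x \<in> ?f ` (UNIV \<times> scaleF.span B)"
      by (intro image_eqI[of _ _ "(k, x - scaleF k a)"]) auto
  next
    fix x assume "x \<in> ?f ` (UNIV \<times> scaleF.span B)"
    then obtain k z where "x = scaleF k a + z" "z \<in> scaleF.span B" by auto
    then show "x \<in> {x. \<exists>k. x - scaleF k a \<in> scaleF.span B}"
      by (intro CollectI exI[of _ k]) simp
  qed
  have "inj_on ?f (UNIV \<times> scaleF.span B)"
  proof (rule inj_onI, clarify)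
    fix c d x y
    assume xy: "x \<in> scaleF.span B" "y \<in> scaleF.span B"
      and e: "scaleF c a + x = scaleF d a + y"
    have e': "scaleF (c - d) a = y - x"
      using e by (simp add: scaleF.scale_left_diff_distrib algebra_simps)
    have "c = d"
    proof (rule ccontr)
      assume "c \<noteq> d"
      then have "a = scaleF (inverse (c - d)) (scaleF (c - d) a)"
        by simp
      also have "\<dots> \<in> scaleF.span B"
        unfolding e' by (intro scaleF.span_scale scaleF.span_diff xy)
      finally show False using a by simp
    qed
    then show "c = d \<and> x = y" using e by simp
  qed
  then show ?case
    using insert.IH[OF B] insert.hyps unfolding eq
    by (simp add: card_image card_cartesian_product)
qed

lemma card_subspace:
  fixes U :: "(nat \<Rightarrow> 'a::{field,finite}) set"
  assumes "scaleF.subspace U" "finite U"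
  shows "card U = CARD('a) ^ scaleF.dim U"
proof -
  obtain B where B: "B \<subseteq> U" "scaleF.independent B" "U \<subseteq> scaleF.span B" "card B = scaleF.dim U"
    using scaleF.basis_exists by blast
  have "scaleF.span B = U"
    using B assms(1) by (simp add: scaleF.span_minimal subset_antisym)
  then show ?thesis
    using card_span_independent[of B] B finite_subset[OF B(1) assms(2)] by simp
qed

text \<open>Since q \<ge> 2, the size q^k of a subspace determines its dimension k. Dimension
  conditions thereby become counting conditions.\<close>

lemma subspaces_dim_eq:
  "subspaces_dim v k = {U :: (nat \<Rightarrow> 'a::{field,finite}) set.
     U \<subseteq> fspace v \<and> scaleF.subspace U \<and> card U = CARD('a) ^ k}"
  unfolding subspaces_dim_def
  using CARD_field_ge_2[where 'a = 'a]
  by (auto simp: card_subspace finite_subset[OF _ finite_fspace])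

section \<open>Points and hyperplanes described by their sizes, and the number of points in a
  subspace\<close>

lemma PG_points_eq:
  "PG_points v = {U :: (nat \<Rightarrow> 'a::{field,finite}) set.
     U \<subseteq> fspace v \<and> scaleF.subspace U \<and> card U = CARD('a)}"
  by (simp add: PG_points_def subspaces_dim_eq)

lemma PG_hyperplanes_eq:
  "PG_hyperplanes v = {U :: (nat \<Rightarrow> 'a::{field,finite}) set.
     U \<subseteq> fspace v \<and> scaleF.subspace U \<and> card U = CARD('a) ^ (v - 1)}"
  by (simp add: PG_hyperplanes_def subspaces_dim_eq)

lemma finite_PG_points: "finite (PG_points v :: (nat \<Rightarrow> 'a::{field,finite}) set set)"
  by (rule finite_subset[of _ "Pow (fspace v)"]) (auto simp: PG_points_eq finite_fspace)

lemma inj_scaleF: "x \<noteq> 0 \<Longrightarrow> inj (\<lambda>c. scaleF c x)"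
  by (auto intro: injI)

lemma PG_point_generated:
  fixes P :: "(nat \<Rightarrow> 'a::{field,finite}) set"
  assumes "P \<in> PG_points v" "x \<in> P" "x \<noteq> 0"
  shows "P = range (\<lambda>c. scaleF c x)"
proof (rule sym, rule card_subset_eq)
  show "finite P" using assms finite_subset[OF _ finite_fspace] by (auto simp: PG_points_eq)
  show "range (\<lambda>c. scaleF c x) \<subseteq> P"
    using assms by (auto simp: PG_points_eq intro: scaleF.subspace_scale)
  show "card (range (\<lambda>c. scaleF c x)) = card P"
    using assms by (simp add: PG_points_eq card_image inj_scaleF)
qed

lemma range_scaleF_in_PG_points:
  fixes x :: "nat \<Rightarrow> 'a::{field,finite}"
  assumes "x \<in> fspace v" "x \<noteq> 0"
  shows "range (\<lambda>c. scaleF c x) \<in> PG_points v"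
proof -
  have "scaleF.subspace (range (\<lambda>c. scaleF c x))"
    using scaleF.subspace_span[of "{x}"] by (simp add: scaleF.span_singleton)
  then show ?thesis using assms
    by (auto simp: PG_points_eq card_image inj_scaleF intro: scaleF.subspace_scale[OF subspace_fspace])
qed

lemma PG_point_nonzero:
  fixes P :: "(nat \<Rightarrow> 'a::{field,finite}) set"
  assumes "P \<in> PG_points v"
  obtains x where "x \<in> P" "x \<noteq> 0" "x \<in> fspace v"
proof -
  have "\<not> P \<subseteq> {0}"
    using card_mono[of "{0}" P] assms CARD_field_ge_2[where 'a = 'a] by (auto simp: PG_points_eq)
  then show ?thesis using assms that by (auto simp: PG_points_eq)
qed

text \<open>Two distinct points share only the zero vector, so the points inside \<open>W\<close>
  partition its nonzero vectors into classes of size q - 1.\<close>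

lemma card_points_in_subspace:
  fixes W :: "(nat \<Rightarrow> 'a::{field,finite}) set"
  assumes W: "W \<subseteq> fspace v" "scaleF.subspace W"
  shows "card {P \<in> PG_points v. P \<subseteq> W} * (CARD('a) - 1) + 1 = card W"
proof -
  let ?S = "{P \<in> PG_points v. P \<subseteq> W}"
  have fin: "finite W" using W finite_fspace finite_subset by blast
  have 0: "0 \<in> W" using W scaleF.subspace_0 by blast
  have eq: "W - {0} = (\<Union>P\<in>?S. P - {0})"
  proof (intro equalityI subsetI)
    fix x assume x: "x \<in> W - {0}"
    have "range (\<lambda>c. scaleF c x) \<in> ?S"
      using x W by (auto intro!: range_scaleF_in_PG_points scaleF.subspace_scale)
    moreover have "x \<in> range (\<lambda>c. scaleF c x)" by (rule image_eqI[of _ _ 1]) auto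
    ultimately show "x \<in> (\<Union>P\<in>?S. P - {0})" using x by blast
  qed auto
  have "card (W - {0}) = (\<Sum>P\<in>?S. card (P - {0}))"
    unfolding eq
  proof (rule card_UN_disjoint)
    show "\<forall>P\<in>?S. finite (P - {0})" using fin finite_subset by blast
    have "P = Q" if "P \<in> ?S" "Q \<in> ?S" "x \<in> P" "x \<in> Q" "x \<noteq> 0" for P Q x
      using PG_point_generated[of P v x] PG_point_generated[of Q v x] that by simp
    then show "\<forall>P\<in>?S. \<forall>Q\<in>?S. P \<noteq> Q \<longrightarrow> (P - {0}) \<inter> (Q - {0}) = {}"
      by blast
  qed (simp add: finite_PG_points)
  also have "\<dots> = (\<Sum>P\<in>?S. CARD('a) - 1)"
  proof (rule sum.cong)
    fix P assume "P \<in> ?S"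
    then have "0 \<in> P" "card P = CARD('a)" by (auto simp: PG_points_eq scaleF.subspace_0)
    then show "card (P - {0}) = CARD('a) - 1" by simp
  qed simp
  finally have "card (W - {0}) = card ?S * (CARD('a) - 1)" by simp
  then show ?thesis using 0 fin by (metis Suc_eq_plus1 card_Suc_Diff1)
qed

text \<open>With N points in \<open>W\<close>, the number N (q - 1) + 1 is divisible by q, and q - 1
  is -1 modulo q.\<close>

lemma card_points_mod:
  fixes W :: "(nat \<Rightarrow> 'a::{field,finite}) set"
  assumes "W \<subseteq> fspace v" "scaleF.subspace W" "CARD('a) dvd card W"
  shows "card {P \<in> PG_points v. P \<subseteq> W} mod CARD('a) = 1"
proof -
  define N where "N = card {P \<in> PG_points v. P \<subseteq> W}"
  have q: "2 \<le> CARD('a)" by (rule CARD_field_ge_2)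
  obtain m where "card W = CARD('a) * m" using assms(3) by blast
  then have "N * (CARD('a) - 1) + 1 = CARD('a) * m"
    using card_points_in_subspace[OF assms(1,2)] by (simp add: N_def)
  \<comment> \<open>Adding \<open>N\<close> to both sides turns N (q - 1) into N q without
    subtracting.\<close>
  then have "N * (CARD('a) - 1) + N + 1 = CARD('a) * m + N" by simp
  moreover have "N * (CARD('a) - 1) + N = CARD('a) * N" using q by (cases "CARD('a)") auto
  ultimately have "CARD('a) * N + 1 = CARD('a) * m + N" by metis
  then have "(CARD('a) * N + 1) mod CARD('a) = (CARD('a) * m + N) mod CARD('a)" by (rule arg_cong)
  then have "N mod CARD('a) = 1 mod CARD('a)" by (metis mod_mult_self4)
  then show ?thesis using q by (simp add: N_def)
qed

text \<open>The dimension formula in counting form: the difference map on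
  \<open>L \<times> H\<close> has kernel a diagonal copy of \<open>L \<inter> H\<close> and at most
  q^v values. Hence \<open>L \<inter> H\<close> has at least q elements, and being a power of q its
  size is divisible by q.\<close>

lemma CARD_dvd_card_Int_hyperplane:
  fixes L H :: "(nat \<Rightarrow> 'a::{field,finite}) set"
  assumes L: "L \<subseteq> fspace v" "scaleF.subspace L" "card L = CARD('a)\<^sup>2"
    and H: "H \<in> PG_hyperplanes v" and v: "v > 0"
  shows "CARD('a) dvd card (L \<inter> H)"
proof -
  let ?q = "CARD('a)"
  have q: "2 \<le> ?q" by (rule CARD_field_ge_2)
  have H': "H \<subseteq> fspace v" "scaleF.subspace H" "card H = ?q ^ (v - 1)"
    using H by (auto simp: PG_hyperplanes_eq)
  have fin: "finite L" "finite H"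
    using L(1) H'(1) finite_fspace finite_subset by blast+
  let ?h = "\<lambda>(x, y). x - y"
  have "card (L \<times> H) = card (?h ` (L \<times> H)) * card {z \<in> L \<times> H. ?h z = 0}"
    by (rule card_eq_card_image_times_kernel)
      (use fin L H' in \<open>auto intro: scaleF.subspace_diff\<close>)
  also have "{z \<in> L \<times> H. ?h z = 0} = (\<lambda>x. (x, x)) ` (L \<inter> H)" by auto
  also have "card \<dots> = card (L \<inter> H)" by (rule card_image) (auto intro: inj_onI)
  finally have eq: "?q ^ 2 * ?q ^ (v - 1) = card (?h ` (L \<times> H)) * card (L \<inter> H)"
    using L(3) H'(3) by (simp only: card_cartesian_product)
  have "?h ` (L \<times> H) \<subseteq> fspace v"
    using L(1) H'(1) by (auto intro!: scaleF.subspace_diff[OF subspace_fspace])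
  then have "card (?h ` (L \<times> H)) \<le> ?q ^ v"
    using card_mono[OF finite_fspace] by (metis card_fspace)
  then have "?q ^ v * ?q \<le> ?q ^ v * card (L \<inter> H)"
    using eq v by (cases v) (auto simp: power2_eq_square algebra_simps)
  then have "?q \<le> card (L \<inter> H)" using q by simp
  moreover have "card (L \<inter> H) = ?q ^ scaleF.dim (L \<inter> H)"
    using L H' fin by (intro card_subspace scaleF.subspace_inter) auto
  ultimately show ?thesis using q
    by (cases "scaleF.dim (L \<inter> H)") auto
qed

section \<open>Linear functionals\<close>

text \<open>The standard dot product. It lets a vector \<open>y\<close> of \<open>fspace v\<close>
  stand for a linear functional, so that functionals are counted as vectors.\<close>

definition pairing :: "nat \<Rightarrow> (nat \<Rightarrow> 'a::field) \<Rightarrow> (nat \<Rightarrow> 'a) \<Rightarrow> 'a" where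
  "pairing v x y = (\<Sum>i<v. x i * y i)"

lemma pairing_commute: "pairing v x y = pairing v y x"
  by (simp add: pairing_def mult.commute)

lemma pairing_diff: "pairing v x (y - z) = pairing v x y - pairing v x z"
  by (simp add: pairing_def algebra_simps sum_subtractf)

lemma pairing_add: "pairing v x (y + z) = pairing v x y + pairing v x z"
  by (simp add: pairing_def algebra_simps sum.distrib)

lemma pairing_scaleF: "pairing v x (scaleF c y) = c * pairing v x y"
  by (simp add: pairing_def scaleF_def sum_distrib_left algebra_simps)

lemma pairing_zero: "pairing v x 0 = 0"
  by (simp add: pairing_def)

lemma pairing_unit: "i < v \<Longrightarrow> pairing v x (0(i := c)) = x i * c"
  by (simp add: pairing_def if_distrib[of "\<lambda>z. _ * z"] sum.delta cong: if_cong)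

lemma subspace_pairing_kernel:
  "scaleF.subspace U \<Longrightarrow> scaleF.subspace {y \<in> U. pairing v x y = 0}"
  by (auto simp: scaleF.subspace_def pairing_zero pairing_add pairing_scaleF)

text \<open>A functional that is nonzero at some \<open>y\<close> in \<open>U\<close> takes every
  value on the multiples of \<open>y\<close>; all q fibres then have the size of the kernel.\<close>

lemma card_pairing_kernel:
  fixes U :: "(nat \<Rightarrow> 'a::{field,finite}) set"
  assumes U: "scaleF.subspace U" "finite U" and y: "y \<in> U" "pairing v x y \<noteq> 0"
  shows "CARD('a) * card {y \<in> U. pairing v x y = 0} = card U"
proof -
  have "pairing v x ` U = UNIV"
  proof (intro equalityI subsetI)
    fix c :: 'a
    have "pairing v x (scaleF (c / pairing v x y) y) = c"
      using y by (simp add: pairing_scaleF)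
    moreover have "scaleF (c / pairing v x y) y \<in> U"
      using U y by (intro scaleF.subspace_scale)
    ultimately show "c \<in> pairing v x ` U" by (metis image_eqI)
  qed simp
  then show ?thesis
    using card_eq_card_image_times_kernel[of U "pairing v x"] U
    by (simp add: pairing_diff scaleF.subspace_diff)
qed

lemma fspace_nonzero_coord:
  assumes "x \<in> fspace v" "x \<noteq> 0"
  obtains i where "i < v" "x i \<noteq> 0"
proof -
  obtain i where "x i \<noteq> 0" using assms(2) by (auto simp: fun_eq_iff)
  moreover from this have "i < v" using assms(1) not_le by (auto simp: fspace_def)
  ultimately show ?thesis using that by blast
qed

lemma card_annihilator:
  fixes x :: "nat \<Rightarrow> 'a::{field,finite}"
  assumes "x \<in> fspace v" "x \<noteq> 0"
  shows "CARD('a) * card {y \<in> fspace v. pairing v x y = 0} = CARD('a) ^ v"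
proof -
  obtain i where i: "i < v" "x i \<noteq> 0" using fspace_nonzero_coord[OF assms] .
  have "0(i := 1) \<in> fspace v" using i by (auto simp: fspace_def)
  moreover have "pairing v x (0(i := 1)) \<noteq> 0" using i by (simp add: pairing_unit)
  ultimately show ?thesis
    using card_pairing_kernel[OF subspace_fspace finite_fspace, of "0(i := 1)" v v x]
    unfolding card_fspace by blast
qed

text \<open>Independent vectors impose independent conditions: \<open>z\<close> is nonzero as a
  functional on the annihilator of \<open>x\<close>, so it cuts that down by a further factor
  q.\<close>

lemma card_annihilator_pair:
  fixes x z :: "nat \<Rightarrow> 'a::{field,finite}"
  assumes x: "x \<in> fspace v" "x \<noteq> 0" and z: "z \<in> fspace v" "z \<notin> range (\<lambda>c. scaleF c x)"
  shows "CARD('a)\<^sup>2 * card {y \<in> fspace v. pairing v x y = 0 \<and> pairing v z y = 0} = CARD('a) ^ v"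
proof -
  let ?K = "{y \<in> fspace v. pairing v x y = 0}"
  obtain i where i: "i < v" "x i \<noteq> 0" using fspace_nonzero_coord[OF x] .
  \<comment> \<open>The only multiple of \<open>x\<close> that could equal \<open>z\<close> is the
    one agreeing with it at \<open>i\<close>; it must fail at some other \<open>j\<close>.\<close>
  have "z \<noteq> scaleF (z i / x i) x" using z by blast
  then obtain j where j: "z j \<noteq> z i / x i * x j" by (auto simp: scaleF_def fun_eq_iff)
  then have jv: "j < v" using x z by (auto simp: fspace_def not_less[symmetric])
  \<comment> \<open>Pairing this vector with \<open>w\<close> gives the 2 by 2 minor w_j x_i - w_i
    x_j: zero for \<open>w = x\<close>, nonzero for \<open>w = z\<close> by the choice of
    \<open>j\<close>.\<close>
  define y where "y = 0(j := x i) - 0(i := x j)"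
  have "y \<in> ?K" using i jv
    by (auto simp: y_def pairing_diff pairing_unit fspace_def)
  moreover have "pairing v z y \<noteq> 0" using i j jv
    by (auto simp: y_def pairing_diff pairing_unit field_simps)
  ultimately have "CARD('a) * card {y \<in> ?K. pairing v z y = 0} = card ?K"
    by (intro card_pairing_kernel)
      (auto simp: finite_fspace intro: subspace_pairing_kernel subspace_fspace)
  moreover have "{y \<in> ?K. pairing v z y = 0} = {y \<in> fspace v. pairing v x y = 0 \<and> pairing v z y = 0}"
    by auto
  ultimately show ?thesis
    using card_annihilator[OF x] by (simp add: power2_eq_square mult.assoc)
qed

text \<open>For nonzero \<open>y\<close> in \<open>fspace v\<close> this is a hyperplane, while
  \<open>y = 0\<close> gives the whole space. Keeping \<open>y = 0\<close> in the sums makes all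
  incidence counts pure powers of q.\<close>

definition kernel_of :: "nat \<Rightarrow> (nat \<Rightarrow> 'a::field) \<Rightarrow> (nat \<Rightarrow> 'a) set" where
  "kernel_of v y = {x \<in> fspace v. pairing v y x = 0}"

lemma kernel_of_in_PG_hyperplanes:
  fixes y :: "nat \<Rightarrow> 'a::{field,finite}"
  assumes "y \<in> fspace v" "y \<noteq> 0"
  shows "kernel_of v y \<in> PG_hyperplanes v"
proof -
  have "v > 0" using fspace_nonzero_coord[OF assms] by auto
  then have "card (kernel_of v y) = CARD('a) ^ (v - 1)"
    using card_annihilator[OF assms] CARD_field_ge_2[where 'a = 'a]
    by (cases v) (auto simp: kernel_of_def)
  then show ?thesis
    by (auto simp: PG_hyperplanes_eq kernel_of_def intro: subspace_pairing_kernel subspace_fspace)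
qed

section \<open>Moments of the hyperplane intersection numbers\<close>

lemma point_subset_kernel_iff:
  fixes P :: "(nat \<Rightarrow> 'a::{field,finite}) set"
  assumes "P \<in> PG_points v" "x \<in> P" "x \<noteq> 0"
  shows "P \<subseteq> kernel_of v y \<longleftrightarrow> pairing v x y = 0"
proof
  assume "P \<subseteq> kernel_of v y"
  then show "pairing v x y = 0" using assms by (auto simp: kernel_of_def pairing_commute)
next
  assume "pairing v x y = 0"
  moreover have "P \<subseteq> fspace v" using assms by (simp add: PG_points_eq)
  ultimately show "P \<subseteq> kernel_of v y"
    using PG_point_generated[OF assms]
    by (auto simp: kernel_of_def pairing_scaleF pairing_commute[of v x])
qed

lemma card_kernels_through_point:
  fixes P :: "(nat \<Rightarrow> 'a::{field,finite}) set"
  assumes "P \<in> PG_points v"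
  shows "CARD('a) * card {y \<in> fspace v. P \<subseteq> kernel_of v y} = CARD('a) ^ v"
proof -
  obtain x where "x \<in> P" "x \<noteq> 0" "x \<in> fspace v" using PG_point_nonzero[OF assms] .
  then show ?thesis using card_annihilator[of x v] by (simp add: point_subset_kernel_iff[OF assms])
qed

lemma card_kernels_through_two_points:
  fixes P Q :: "(nat \<Rightarrow> 'a::{field,finite}) set"
  assumes P: "P \<in> PG_points v" and Q: "Q \<in> PG_points v" and "P \<noteq> Q"
  shows "CARD('a)\<^sup>2 * card {y \<in> fspace v. P \<subseteq> kernel_of v y \<and> Q \<subseteq> kernel_of v y} = CARD('a) ^ v"
proof -
  obtain x where x: "x \<in> P" "x \<noteq> 0" "x \<in> fspace v" using PG_point_nonzero[OF P] .
  obtain z where z: "z \<in> Q" "z \<noteq> 0" "z \<in> fspace v" using PG_point_nonzero[OF Q] .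
  have "z \<notin> range (\<lambda>c. scaleF c x)"
    using PG_point_generated[OF P x(1,2)] PG_point_generated[OF P _ z(2)]
      PG_point_generated[OF Q z(1,2)] \<open>P \<noteq> Q\<close> by metis
  then show ?thesis
    using card_annihilator_pair[of x v z] x z
    by (simp add: point_subset_kernel_iff[OF P] point_subset_kernel_iff[OF Q])
qed

text \<open>Double counting of incident pairs of a point and a functional: each point lies in
  q^(v-1) kernels. The factor q on the left keeps the exponent free of subtraction.\<close>

lemma sum_intersection_numbers:
  fixes C :: "(nat \<Rightarrow> 'a::{field,finite}) set set"
  assumes C: "C \<subseteq> PG_points v"
  shows "CARD('a) * (\<Sum>y\<in>fspace v. card {P \<in> C. P \<subseteq> kernel_of v y}) = card C * CARD('a) ^ v"
proof -
  have fin: "finite C" using C finite_PG_points finite_subset by blast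
  have "(\<Sum>y\<in>fspace v. card {P \<in> C. P \<subseteq> kernel_of v y})
      = (\<Sum>y\<in>fspace v. \<Sum>P\<in>C. of_bool (P \<subseteq> kernel_of v y))"
    using fin by (simp add: sum.If_cases Int_def)
  also have "\<dots> = (\<Sum>P\<in>C. \<Sum>y\<in>fspace v. of_bool (P \<subseteq> kernel_of v y))"
    by (rule sum.swap)
  also have "\<dots> = (\<Sum>P\<in>C. card {y \<in> fspace v. P \<subseteq> kernel_of v y})"
    by (simp add: sum.If_cases Int_def finite_fspace)
  finally have "CARD('a) * (\<Sum>y\<in>fspace v. card {P \<in> C. P \<subseteq> kernel_of v y})
      = (\<Sum>P\<in>C. CARD('a) * card {y \<in> fspace v. P \<subseteq> kernel_of v y})"
    by (simp add: sum_distrib_left)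
  also have "\<dots> = (\<Sum>P\<in>C. CARD('a) ^ v)"
    by (rule sum.cong) (use C card_kernels_through_point in auto)
  finally show ?thesis by simp
qed

text \<open>The square counts ordered pairs of points in a common kernel. After scaling by q^2, a
  diagonal pair contributes q q^v and a pair of distinct points q^v.\<close>

lemma sum_squared_intersection_numbers:
  fixes C :: "(nat \<Rightarrow> 'a::{field,finite}) set set"
  assumes C: "C \<subseteq> PG_points v"
  shows "CARD('a)\<^sup>2 * (\<Sum>y\<in>fspace v. (card {P \<in> C. P \<subseteq> kernel_of v y})\<^sup>2)
    = (card C * CARD('a) + card C * (card C - 1)) * CARD('a) ^ v"
proof -
  let ?q = "CARD('a)"
  let ?N = "\<lambda>P Q. card {y \<in> fspace v. P \<subseteq> kernel_of v y \<and> Q \<subseteq> kernel_of v y}"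
  have fin: "finite C" using C finite_PG_points finite_subset by blast
  have "(\<Sum>y\<in>fspace v. (card {P \<in> C. P \<subseteq> kernel_of v y})\<^sup>2)
      = (\<Sum>y\<in>fspace v. (\<Sum>P\<in>C. of_bool (P \<subseteq> kernel_of v y))\<^sup>2)"
    using fin by (simp add: sum.If_cases Int_def)
  also have "\<dots> = (\<Sum>y\<in>fspace v. \<Sum>P\<in>C. \<Sum>Q\<in>C. of_bool (P \<subseteq> kernel_of v y \<and> Q \<subseteq> kernel_of v y))"
    by (simp only: power2_eq_square sum_product of_bool_conj)
  also have "\<dots> = (\<Sum>P\<in>C. \<Sum>y\<in>fspace v. \<Sum>Q\<in>C. of_bool (P \<subseteq> kernel_of v y \<and> Q \<subseteq> kernel_of v y))"
    by (rule sum.swap)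
  also have "\<dots> = (\<Sum>P\<in>C. \<Sum>Q\<in>C. \<Sum>y\<in>fspace v. of_bool (P \<subseteq> kernel_of v y \<and> Q \<subseteq> kernel_of v y))"
    by (intro sum.cong refl sum.swap)
  also have "\<dots> = (\<Sum>P\<in>C. \<Sum>Q\<in>C. ?N P Q)"
    by (simp add: sum.If_cases Int_def finite_fspace del: of_bool_conj)
  finally have "?q\<^sup>2 * (\<Sum>y\<in>fspace v. (card {P \<in> C. P \<subseteq> kernel_of v y})\<^sup>2)
      = (\<Sum>P\<in>C. \<Sum>Q\<in>C. ?q\<^sup>2 * ?N P Q)"
    by (simp add: sum_distrib_left)
  also have "\<dots> = (\<Sum>P\<in>C. ?q * ?q ^ v + (card C - 1) * ?q ^ v)"
  proof (rule sum.cong[OF refl])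
    fix P assume P: "P \<in> C"
    have "(\<Sum>Q\<in>C. ?q\<^sup>2 * ?N P Q) = ?q\<^sup>2 * ?N P P + (\<Sum>Q\<in>C - {P}. ?q\<^sup>2 * ?N P Q)"
      using fin P by (rule sum.remove)
    also have "?q\<^sup>2 * ?N P P = ?q * ?q ^ v"
      using card_kernels_through_point[of P v] P C by (auto simp: power2_eq_square mult.assoc)
    also have "(\<Sum>Q\<in>C - {P}. ?q\<^sup>2 * ?N P Q) = (\<Sum>Q\<in>C - {P}. ?q ^ v)"
      by (rule sum.cong) (use P C in \<open>auto intro!: card_kernels_through_two_points\<close>)
    finally show "(\<Sum>Q\<in>C. ?q\<^sup>2 * ?N P Q) = ?q * ?q ^ v + (card C - 1) * ?q ^ v"
      using P fin by simp
  qed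
  also have "\<dots> = (card C * ?q + card C * (card C - 1)) * ?q ^ v"
    by (simp add: algebra_simps)
  finally show ?thesis .
qed

section \<open>The possible cardinalities\<close>

text \<open>In the first moment modulo q, the zero functional contributes n and the other q^v - 1
  contribute u each, so n - u vanishes modulo q. Two points are required so that v \<ge> 2 and the
  total n q^(v-1) is divisible by q.\<close>

lemma divisible_set_card_cong:
  fixes C :: "(nat \<Rightarrow> 'a::{field,finite}) set set"
  assumes div: "divisible_set CARD('a) v C" and n: "2 \<le> card C" and y: "y \<in> fspace v"
  shows "card {P \<in> C. P \<subseteq> kernel_of v y} mod CARD('a) = card C mod CARD('a)"
proof -
  let ?q = "CARD('a)" and ?V = "fspace v :: (nat \<Rightarrow> 'a) set"
  let ?s = "\<lambda>y. card {P \<in> C. P \<subseteq> kernel_of v y}"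
  have q: "2 \<le> ?q" by (rule CARD_field_ge_2)
  have C: "C \<subseteq> PG_points v" using div by (simp add: divisible_set_def)
  obtain u where "\<forall>H\<in>PG_hyperplanes v. card {P \<in> C. P \<subseteq> H} mod ?q = u mod ?q"
    using div by (auto simp: divisible_set_def)
  then have u: "?s y mod ?q = u mod ?q" if "y \<in> ?V - {0}" for y
    using that kernel_of_in_PG_hyperplanes by blast
  have s0: "?s 0 = card C"
  proof -
    have "{P \<in> C. P \<subseteq> kernel_of v 0} = C"
      using C by (auto simp: kernel_of_def pairing_commute[of v 0] pairing_zero PG_points_eq)
    then show ?thesis by simp
  qed
  have 0: "0 \<in> ?V" by (rule scaleF.subspace_0[OF subspace_fspace])
  have "finite C" by (rule finite_subset[OF C finite_PG_points])
  then obtain P Q where PQ: "P \<in> C" "Q \<in> C" "P \<noteq> Q"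
    using n card_le_Suc0_iff_eq[of C] by auto
  then have "P \<in> PG_points v" "Q \<in> PG_points v" using C by auto
  \<comment> \<open>Functionals vanishing at both points number q^v / q^2, which forces v \<ge>
    2.\<close>
  from card_kernels_through_two_points[OF this PQ(3), symmetric]
  have "?q\<^sup>2 dvd ?q ^ v" by (rule dvdI)
  then have v: "2 \<le> v" using q by (simp add: power_dvd_imp_le)
  have "?q * (\<Sum>y\<in>?V. ?s y) = ?q * (card C * ?q ^ (v - 1))"
    using sum_intersection_numbers[OF C] v by (cases v) auto
  then have "(\<Sum>y\<in>?V. ?s y) = card C * ?q ^ (v - 1)" using q by simp
  then have "card C + (\<Sum>y\<in>?V - {0}. ?s y) = card C * ?q ^ (v - 1)"
    using sum.remove[OF finite_fspace 0, of ?s] s0 by simp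
  moreover have "?q ^ (v - 1) mod ?q = 0" using v by (simp add: dvd_power)
  ultimately have m: "(card C + (\<Sum>y\<in>?V - {0}. ?s y)) mod ?q = 0"
    by (metis mod_mult_right_eq mult_0_right mod_0)
  have "(\<Sum>y\<in>?V - {0}. ?s y) mod ?q = (\<Sum>y\<in>?V - {0}. ?s y mod ?q) mod ?q"
    by (simp add: mod_sum_eq)
  also have "\<dots> = (\<Sum>y\<in>?V - {0}. u mod ?q) mod ?q"
    using u by (metis (no_types, lifting) sum.cong)
  also have "\<dots> = (u * (?q ^ v - 1)) mod ?q"
    using 0 finite_fspace[where 'a = 'a] card_fspace[where 'a = 'a]
    by (simp add: mod_mult_left_eq mod_mult_right_eq mult.commute)
  finally have "(\<Sum>y\<in>?V - {0}. ?s y) mod ?q = (u * (?q ^ v - 1)) mod ?q" .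
  from mod_add_cong[OF refl this, of "card C"]
  have "(card C + u * (?q ^ v - 1)) mod ?q = 0"
    using m by simp
  \<comment> \<open>Adding u replaces u (q^v - 1) by u q^v, which vanishes modulo q.\<close>
  then have "(card C + u * (?q ^ v - 1) + u) mod ?q = u mod ?q"
    using mod_add_left_eq[of "card C + u * (?q ^ v - 1)" ?q u] by simp
  moreover have "card C + u * (?q ^ v - 1) + u = card C + u * ?q ^ v"
    using q by (cases "?q ^ v") auto
  moreover have "(card C + u * ?q ^ v) mod ?q = card C mod ?q"
    using v by (cases v) (auto simp: mult.left_commute[of u])
  ultimately have "u mod ?q = card C mod ?q" by metis
  then show ?thesis using u y s0 by (cases "y = 0") auto
qed

text \<open>The mean of s over all functionals is n/q, and the zero functional has s = n, strictly
  above it; hence some value is strictly below.\<close>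

lemma exists_small_hyperplane:
  fixes C :: "(nat \<Rightarrow> 'a::{field,finite}) set set"
  assumes C: "C \<subseteq> PG_points v" and n: "0 < card C"
  shows "\<exists>y\<in>fspace v. CARD('a) * card {P \<in> C. P \<subseteq> kernel_of v y} < card C"
proof (rule ccontr)
  let ?q = "CARD('a)" and ?V = "fspace v :: (nat \<Rightarrow> 'a) set"
  let ?s = "\<lambda>y. card {P \<in> C. P \<subseteq> kernel_of v y}"
  assume "\<not> (\<exists>y\<in>?V. ?q * ?s y < card C)"
  then have le: "card C \<le> ?q * ?s y" if "y \<in> ?V" for y
    using that by (simp add: not_less)
  have q: "2 \<le> ?q" by (rule CARD_field_ge_2)
  have "{P \<in> C. P \<subseteq> kernel_of v 0} = C"
    using C by (auto simp: kernel_of_def pairing_commute[of v 0] pairing_zero PG_points_eq)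
  then have "card C < ?q * ?s 0" using q n by simp
  then have "(\<Sum>y\<in>?V. card C) < (\<Sum>y\<in>?V. ?q * ?s y)"
    using le scaleF.subspace_0[OF subspace_fspace] by (intro sum_strict_mono_ex1 finite_fspace) auto
  then show False
    using sum_intersection_numbers[OF C]
    by (simp add: sum_distrib_left[symmetric] card_fspace mult.commute)
qed

text \<open>The quadratic form is q^2 times the mean of (s(y) - c) (s(y) - c - q).\<close>

lemma quadratic_negative:
  fixes q n c d :: int
  assumes "n = (c + d) * q + c" "0 \<le> c" "1 \<le> d" "c + d \<le> q - 1"
  shows "(n - c * q) * (n - c * q - q\<^sup>2) + n * (q - 1) < 0"
proof -
  have q: "2 \<le> q" using assms by linarith
  \<comment> \<open>The bound on c + d gives q - d \<ge> c + 1, and the next inequality replaces d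
    by 1 in the remaining product. What is left is the negative of q + c + c^2 (q - 1).\<close>
  have "(d * q + c) * (q * (c + 1) - c) \<le> (d * q + c) * (q * (q - d) - c)"
    using assms q by (intro mult_left_mono diff_right_mono add_nonneg_nonneg mult_nonneg_nonneg) auto
  moreover have "(q + c) * (c * (q - 1) + 1) \<le> (d * q + c) * (c * (q - 1) + 1)"
    using assms q by (intro mult_right_mono add_nonneg_nonneg mult_nonneg_nonneg add_right_mono) auto
  moreover have "0 \<le> c * c * (q - 1)" using assms q by simp
  moreover have "(n - c * q) * (n - c * q - q\<^sup>2) + n * (q - 1)
      = - ((d * q + c) * (q * (q - d) - c)) + ((c + d) * q + c) * (q - 1)"
    unfolding assms(1) by (simp add: algebra_simps power2_eq_square)
  moreover have "(d * q + c) * (q * (c + 1) - c) - ((c + d) * q + c) * (q - 1)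
      = (d * q + c) * (c * (q - 1) + 1) - c * q * (q - 1)"
    by (simp add: algebra_simps)
  moreover have "(q + c) * (c * (q - 1) + 1) - c * q * (q - 1) = q + c + c * c * (q - 1)"
    by (simp add: algebra_simps)
  ultimately show ?thesis using assms(2) q by linarith
qed

lemma card_divisible_set:
  fixes C :: "(nat \<Rightarrow> 'a::{field,finite}) set set"
  assumes div: "divisible_set CARD('a) v C" and n: "2 \<le> card C" "card C < CARD('a)\<^sup>2"
  shows "(CARD('a) + 1) dvd card C"
proof -
  let ?q = "CARD('a)" and ?V = "fspace v :: (nat \<Rightarrow> 'a) set"
  let ?s = "\<lambda>y. card {P \<in> C. P \<subseteq> kernel_of v y}"
  have q: "2 \<le> ?q" by (rule CARD_field_ge_2)
  have C: "C \<subseteq> PG_points v" using div by (simp add: divisible_set_def)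
  define c A where "c = card C mod ?q" and "A = card C div ?q"
  have nA: "card C = A * ?q + c" by (simp add: c_def A_def)
  have cq: "c < ?q" using q by (simp add: c_def)
  have s: "?s y mod ?q = c" if "y \<in> ?V" for y
    unfolding c_def by (rule divisible_set_card_cong[OF div n(1) that])
  have "0 < card C" using n by simp
  then obtain y where y: "y \<in> ?V" "?q * ?s y < card C"
    using exists_small_hyperplane[OF C] by blast
  have "c \<le> ?s y" using s[OF y(1)] by (metis mod_less_eq_dividend)
  then have "?q * c < card C" using y(2) by (meson le_less_trans mult_le_mono2)
  then have "?q * c < ?q * (A + 1)" using nA cq by (simp add: algebra_simps)
  then have "c < A + 1" by (simp only: mult_less_cancel1)
  then have "c \<le> A" by simp
  moreover have "\<not> c < A"
  proof
    assume "c < A"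
    \<comment> \<open>Here n < q^2 enters: it gives A \<le> q - 1, the upper bound needed for
      \<open>quadratic_negative\<close>.\<close>
    have "A * ?q < ?q * ?q" using nA n unfolding power2_eq_square by linarith
    then have "A < ?q" by (simp only: mult_less_cancel2)
    define S where "S = (\<Sum>y\<in>?V. (int (?s y) - int c) * (int (?s y) - int c - int ?q))"
    have "0 \<le> S" unfolding S_def
    proof (rule sum_nonneg)
      fix y assume "y \<in> ?V"
      \<comment> \<open>Writing s(y) = j q + c turns the summand into q^2 j (j - 1), which is
        nonnegative because j is a natural number.\<close>
      define j where "j = ?s y div ?q"
      have "?s y = j * ?q + c" using s[OF \<open>y \<in> ?V\<close>] by (metis div_mult_mod_eq j_def)
      then have "(int (?s y) - int c) * (int (?s y) - int c - int ?q)
          = (int ?q)\<^sup>2 * (int j * (int j - 1))"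
        by (simp add: algebra_simps power2_eq_square)
      also have "\<dots> \<ge> 0" by (cases "j = 0") auto
      finally show "0 \<le> (int (?s y) - int c) * (int (?s y) - int c - int ?q)" .
    qed
    let ?n = "int (card C)"
    have m1: "int ?q * (\<Sum>y\<in>?V. int (?s y)) = ?n * int ?q ^ v"
      using arg_cong[OF sum_intersection_numbers[OF C], of int] by simp
    have m2: "(int ?q)\<^sup>2 * (\<Sum>y\<in>?V. (int (?s y))\<^sup>2) = (?n * int ?q + ?n * (?n - 1)) * int ?q ^ v"
      using arg_cong[OF sum_squared_intersection_numbers[OF C], of int] n by (simp add: of_nat_diff)
    have "S = (\<Sum>y\<in>?V. (int (?s y))\<^sup>2 - (2 * int c + int ?q) * int (?s y) + int c * (int c + int ?q))"
      unfolding S_def by (rule sum.cong) (auto simp: algebra_simps power2_eq_square)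
    also have "\<dots> = (\<Sum>y\<in>?V. (int (?s y))\<^sup>2) - (2 * int c + int ?q) * (\<Sum>y\<in>?V. int (?s y))
        + int c * (int c + int ?q) * int ?q ^ v"
      by (simp add: sum.distrib sum_subtractf sum_distrib_left card_fspace)
    finally have S: "S = (\<Sum>y\<in>?V. (int (?s y))\<^sup>2) - (2 * int c + int ?q) * (\<Sum>y\<in>?V. int (?s y))
        + int c * (int c + int ?q) * int ?q ^ v" .
    \<comment> \<open>The factor q^2 allows both moment identities to be substituted without
      division.\<close>
    have "(int ?q)\<^sup>2 * S = (int ?q)\<^sup>2 * (\<Sum>y\<in>?V. (int (?s y))\<^sup>2)
        - (2 * int c + int ?q) * int ?q * (int ?q * (\<Sum>y\<in>?V. int (?s y)))
        + (int ?q)\<^sup>2 * (int c * (int c + int ?q) * int ?q ^ v)"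
      unfolding S by (simp add: algebra_simps power2_eq_square)
    also have "\<dots> = int ?q ^ v *
        ((?n - int c * int ?q) * (?n - int c * int ?q - (int ?q)\<^sup>2) + ?n * (int ?q - 1))"
      unfolding m1 m2 by (simp add: algebra_simps power2_eq_square)
    also have "\<dots> < 0"
    proof (rule mult_pos_neg)
      show "(?n - int c * int ?q) * (?n - int c * int ?q - (int ?q)\<^sup>2) + ?n * (int ?q - 1) < 0"
        by (rule quadratic_negative[where d = "int A - int c"])
          (use nA \<open>c < A\<close> \<open>A < ?q\<close> in auto)
    qed (use q in simp)
    finally show False using \<open>0 \<le> S\<close> by (simp add: mult_less_0_iff)
  qed
  ultimately have "card C = (?q + 1) * c" using nA by (simp add: algebra_simps)
  then show ?thesis by (rule dvdI)
qed

section \<open>Constructions\<close>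

text \<open>The span of the unit vectors with indices 2i and 2i + 1, which is a line of the
  projective space. Distinct i use disjoint coordinate blocks.\<close>

definition coord_line :: "nat \<Rightarrow> (nat \<Rightarrow> 'a::field) set" where
  "coord_line i = {x. \<forall>j. j \<noteq> 2 * i \<and> j \<noteq> 2 * i + 1 \<longrightarrow> x j = 0}"

lemma subspace_coord_line: "scaleF.subspace (coord_line i)"
  by (auto simp: scaleF.subspace_def coord_line_def scaleF_def)

lemma coord_line_subset: "i < a \<Longrightarrow> coord_line i \<subseteq> fspace (2 * a)"
  by (auto simp: coord_line_def fspace_def)

lemma card_coord_line: "card (coord_line i :: (nat \<Rightarrow> 'a::{field,finite}) set) = CARD('a)\<^sup>2"
proof -
  let ?f = "\<lambda>x :: nat \<Rightarrow> 'a. (x (2 * i), x (2 * i + 1))"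
  let ?g = "\<lambda>(b, c). (\<lambda>j. if j = 2 * i then b else if j = 2 * i + 1 then c else 0)"
  have "bij_betw ?f (coord_line i) (UNIV \<times> UNIV)"
    by (rule bij_betw_byWitness[where f' = ?g]) (auto simp: coord_line_def fun_eq_iff)
  from bij_betw_same_card[OF this] show ?thesis
    by (simp only: card_cartesian_product power2_eq_square)
qed

lemma coord_line_Int: "i \<noteq> j \<Longrightarrow> coord_line i \<inter> coord_line j = {0 :: nat \<Rightarrow> 'a::field}"
proof (intro equalityI subsetI)
  fix x :: "nat \<Rightarrow> 'a" assume ij: "i \<noteq> j" and x: "x \<in> coord_line i \<inter> coord_line j"
  have "x k = 0" for k
  \<comment> \<open>The coordinate k belongs only to block \<open>k div 2\<close>, so at least one
    of the two lines forces it to vanish.\<close>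
  proof (cases "k div 2 = i")
    case True
    then have "k \<noteq> 2 * j \<and> k \<noteq> 2 * j + 1" using ij by presburger
    then show ?thesis using x by (simp add: coord_line_def)
  next
    case False
    then have "k \<noteq> 2 * i \<and> k \<noteq> 2 * i + 1" by presburger
    then show ?thesis using x by (simp add: coord_line_def)
  qed
  then show "x \<in> {0}" by (auto simp: fun_eq_iff)
qed (auto simp: coord_line_def)

lemma card_points_in_line:
  fixes W :: "(nat \<Rightarrow> 'a::{field,finite}) set"
  assumes "W \<subseteq> fspace v" "scaleF.subspace W" "card W = CARD('a)\<^sup>2"
  shows "card {P \<in> PG_points v. P \<subseteq> W} = CARD('a) + 1"
proof -
  \<comment> \<open>With q = r + 2, the factor q - 1 becomes \<open>Suc r\<close> and cancels in the
    point count.\<close>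
  obtain r where r: "CARD('a) = Suc (Suc r)"
    using CARD_field_ge_2[where 'a = 'a] by (metis add_2_eq_Suc le_Suc_ex)
  have "card {P \<in> PG_points v. P \<subseteq> W} * Suc r = (r + 3) * Suc r"
    using card_points_in_subspace[OF assms(1,2)] assms(3) r
    by (simp add: power2_eq_square algebra_simps)
  then show ?thesis using r by (simp only: mult_cancel2) simp
qed

text \<open>The points on \<open>a\<close> pairwise disjoint lines work: each line meets every
  hyperplane in 1 modulo q points, so the common residue is that of \<open>a\<close>.\<close>

lemma divisible_set_lines:
  "\<exists>v (C :: (nat \<Rightarrow> 'a::{field,finite}) set set).
     divisible_set CARD('a) v C \<and> card C = a * (CARD('a) + 1)"
proof (intro exI conjI)
  let ?q = "CARD('a)"
  define L where "L i = {P \<in> PG_points (2 * a). P \<subseteq> (coord_line i :: (nat \<Rightarrow> 'a) set)}" for i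
  have fin: "finite (L i)" for i by (simp add: L_def finite_PG_points)
  have disj: "L i \<inter> L j = {}" if "i \<noteq> j" for i j
  proof -
    have False if "P \<in> L i" "P \<in> L j" for P
    proof -
      have "P \<in> PG_points (2 * a)" "P \<subseteq> {0}"
        using that coord_line_Int[OF \<open>i \<noteq> j\<close>, where 'a = 'a] by (auto simp: L_def)
      then show False using PG_point_nonzero by blast
    qed
    then show ?thesis by blast
  qed
  have "card (\<Union>i<a. L i) = (\<Sum>i<a. card (L i))"
    using fin disj by (intro card_UN_disjoint) auto
  also have "\<dots> = (\<Sum>i<a. ?q + 1)"
    unfolding L_def
    by (intro sum.cong refl card_points_in_line subspace_coord_line coord_line_subset card_coord_line) auto
  finally show "card (\<Union>i<a. L i) = a * (?q + 1)" by simp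
  have "card {P \<in> (\<Union>i<a. L i). P \<subseteq> H} mod ?q = a mod ?q" if H: "H \<in> PG_hyperplanes (2 * a)" for H
  proof -
    have one: "card {P \<in> L i. P \<subseteq> H} mod ?q = 1" if "i < a" for i
    proof -
      have "{P \<in> L i. P \<subseteq> H} = {P \<in> PG_points (2 * a). P \<subseteq> coord_line i \<inter> H}"
        by (auto simp: L_def)
      moreover have "card {P \<in> PG_points (2 * a). P \<subseteq> coord_line i \<inter> H} mod ?q = 1"
      proof (rule card_points_mod)
        show "coord_line i \<inter> H \<subseteq> fspace (2 * a)" using coord_line_subset[OF that] by blast
        show "scaleF.subspace (coord_line i \<inter> H)"
          using H by (intro scaleF.subspace_inter subspace_coord_line) (simp add: PG_hyperplanes_eq)
        show "?q dvd card (coord_line i \<inter> H)"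
          by (rule CARD_dvd_card_Int_hyperplane[OF coord_line_subset subspace_coord_line
                card_coord_line H]) (use that in auto)
      qed
      ultimately show ?thesis by simp
    qed
    have "{P \<in> (\<Union>i<a. L i). P \<subseteq> H} = (\<Union>i<a. {P \<in> L i. P \<subseteq> H})" by auto
    then have "card {P \<in> (\<Union>i<a. L i). P \<subseteq> H} = card (\<Union>i<a. {P \<in> L i. P \<subseteq> H})" by simp
    also have "\<dots> = (\<Sum>i<a. card {P \<in> L i. P \<subseteq> H})"
      using fin disj by (intro card_UN_disjoint) auto
    also have "\<dots> mod ?q = (\<Sum>i<a. card {P \<in> L i. P \<subseteq> H} mod ?q) mod ?q"
      by (simp add: mod_sum_eq)
    also have "\<dots> = a mod ?q" using one by simp
    finally show ?thesis .
  qed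
  then show "divisible_set ?q (2 * a) (\<Union>i<a. L i)"
    unfolding divisible_set_def by (auto simp: L_def)
qed

text \<open>Removing a line from the projective plane leaves q^2 points. A hyperplane and its
  intersection with the removed line both contain 1 modulo q points, so the difference is 0 modulo
  q.\<close>

lemma divisible_set_affine_plane:
  "\<exists>v (C :: (nat \<Rightarrow> 'a::{field,finite}) set set).
     divisible_set CARD('a) v C \<and> card C = CARD('a)\<^sup>2"
proof (intro exI conjI)
  let ?q = "CARD('a)"
  let ?P = "PG_points 3 :: (nat \<Rightarrow> 'a) set set"
  define C where "C = {P \<in> ?P. \<not> P \<subseteq> fspace 2}"
  have sub: "fspace 2 \<subseteq> (fspace 3 :: (nat \<Rightarrow> 'a) set)" by (rule fspace_mono) simp
  \<comment> \<open>Taking \<open>W\<close> as the whole space gives the cardinality, taking it as a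
    hyperplane gives divisibility.\<close>
  have split: "card {P \<in> C. P \<subseteq> W} + card {P \<in> ?P. P \<subseteq> fspace 2 \<inter> W} = card {P \<in> ?P. P \<subseteq> W}" for W
  proof -
    have "{P \<in> ?P. P \<subseteq> W} = {P \<in> C. P \<subseteq> W} \<union> {P \<in> ?P. P \<subseteq> fspace 2 \<inter> W}"
      by (auto simp: C_def)
    then show ?thesis
      using finite_PG_points[of 3, where 'a = 'a]
      by (simp add: card_Un_disjoint C_def disjoint_iff)
  qed
  have "card {P \<in> ?P. P \<subseteq> fspace 2} = ?q + 1"
    by (rule card_points_in_line[OF sub subspace_fspace]) (rule card_fspace)
  moreover have "card {P \<in> ?P. P \<subseteq> fspace 3} = ?q\<^sup>2 + ?q + 1"
  proof -
    obtain r where r: "?q = Suc (Suc r)"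
      using CARD_field_ge_2[where 'a = 'a] by (metis add_2_eq_Suc le_Suc_ex)
    have "card {P \<in> ?P. P \<subseteq> fspace 3} * Suc r = (?q\<^sup>2 + ?q + 1) * Suc r"
      using card_points_in_subspace[OF subset_refl subspace_fspace, of 3, where 'a = 'a] r
      by (simp add: card_fspace power2_eq_square power3_eq_cube algebra_simps)
    then show ?thesis by (simp only: mult_cancel2) simp
  qed
  moreover have "fspace 2 \<inter> fspace 3 = (fspace 2 :: (nat \<Rightarrow> 'a) set)" using sub by blast
  moreover have "{P \<in> C. P \<subseteq> fspace 3} = C" by (auto simp: C_def PG_points_eq)
  ultimately show "card C = ?q\<^sup>2" using split[of "fspace 3"] by simp
  have "card {P \<in> C. P \<subseteq> H} mod ?q = 0 mod ?q" if H: "H \<in> PG_hyperplanes 3" for H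
  proof -
    have H': "H \<subseteq> fspace 3" "scaleF.subspace H" "card H = ?q\<^sup>2"
      using H by (auto simp: PG_hyperplanes_eq)
    have "card {P \<in> ?P. P \<subseteq> H} mod ?q = 1"
      using H' by (intro card_points_mod) auto
    moreover have "card {P \<in> ?P. P \<subseteq> fspace 2 \<inter> H} mod ?q = 1"
    proof (rule card_points_mod)
      show "?q dvd card (fspace 2 \<inter> H)"
        by (rule CARD_dvd_card_Int_hyperplane[OF sub subspace_fspace card_fspace H]) simp
    qed (use sub H' in \<open>auto intro: scaleF.subspace_inter subspace_fspace\<close>)
    ultimately have "card {P \<in> ?P. P \<subseteq> H} mod ?q = card {P \<in> ?P. P \<subseteq> fspace 2 \<inter> H} mod ?q"
      by simp
    then have "?q dvd card {P \<in> ?P. P \<subseteq> H} - card {P \<in> ?P. P \<subseteq> fspace 2 \<inter> H}"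
      using split[of H] by (subst mod_eq_dvd_iff_nat[symmetric]) linarith+
    then show ?thesis unfolding split[of H, symmetric] by simp
  qed
  then show "divisible_set ?q 3 C"
    unfolding divisible_set_def by (auto simp: C_def)
qed

section \<open>Restriction of the cardinalities and their realization combined\<close>

theorem theorem5p15:
  fixes q :: nat
  defines "q \<equiv> card (UNIV :: 'a::{field,finite} set)"
  shows "(\<forall>v (C :: (nat \<Rightarrow> 'a) set set).
            divisible_set q v C \<and> 2 \<le> card C \<and> card C \<le> q^2
              \<longrightarrow> card C = q^2 \<or> (q + 1) dvd card C)
       \<and> (\<forall>n. 2 \<le> n \<and> n \<le> q^2 \<and> (n = q^2 \<or> (q + 1) dvd n)
              \<longrightarrow> (\<exists>v (C :: (nat \<Rightarrow> 'a) set set). divisible_set q v C \<and> card C = n))"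
proof (intro conjI allI impI)
  fix v and C :: "(nat \<Rightarrow> 'a) set set"
  assume "divisible_set q v C \<and> 2 \<le> card C \<and> card C \<le> q\<^sup>2"
  then show "card C = q\<^sup>2 \<or> (q + 1) dvd card C"
    unfolding q_def using card_divisible_set[of v C] le_neq_implies_less by blast
next
  fix n
  assume "2 \<le> n \<and> n \<le> q\<^sup>2 \<and> (n = q\<^sup>2 \<or> (q + 1) dvd n)"
  then consider "n = q\<^sup>2" | a where "n = a * (q + 1)"
    by (metis dvdE mult.commute)
  then show "\<exists>v (C :: (nat \<Rightarrow> 'a) set set). divisible_set q v C \<and> card C = n"
    unfolding q_def
    by cases (use divisible_set_affine_plane divisible_set_lines in \<open>simp_all only:\<close>)
qed

end
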